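(* For any integer $k\ge 2$, $$c_k\;\le\;2k\sin\left(\frac{\pi}{k}\right)\;\le\;2\pi-\frac{\pi^3}{3k^2}+\frac{\pi^5}{60k^5}.$$
   Context: Let $\mathcal{C}$ be the unit circle in $\mathbb{R}^2$ centered at the origin, let $R=(1,0)$, and let $d(\cdot,\cdot)$ denote Euclidean distance. For $k\in\mathbb{N}$ and $(T_1,\dots,T_k)\in\mathcal{C}^k$ define $$C(T_1,\dots,T_k)=\min_\sigma\Big(d(R,T_{\sigma(1)})+\sum_{i=2}^k d(T_{\sigma(i-1)},T_{\sigma(i)})\Big),$$ the minimum being over all permutations $\sigma$ of $\{1,\dots,k\}$, and $$c_k=\sup_{(T_1,\dots,T_k)\in\mathcal{C}^k}C(T_1,\dots,T_k).$$
   Formalization: The last term is π^5/(60k^4) instead of the printed π^5/(60k^5): with k^5 the second inequality is false for every k ≥ 2 (at k = 2 it reads 4 ≤ 3.86), and k^4 is what the degree-5 Taylor bound for sine gives. *)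

theory Defs
  imports "HOL-Analysis.Analysis"
begin

definition unit_circle :: "(real ^ 2) set" where
  "unit_circle = sphere 0 1"

definition R :: "real ^ 2" where
  "R = vector [1, 0]"

definition path_cost :: "nat \<Rightarrow> (nat \<Rightarrow> real ^ 2) \<Rightarrow> (nat \<Rightarrow> nat) \<Rightarrow> real" where
  "path_cost k T \<sigma> = dist R (T (\<sigma> 1)) + (\<Sum>i = 2..k. dist (T (\<sigma> (i - 1))) (T (\<sigma> i)))"

definition min_cost :: "nat \<Rightarrow> (nat \<Rightarrow> real ^ 2) \<Rightarrow> real" where
  "min_cost k T = Min (path_cost k T ` {\<sigma>. \<sigma> permutes {1..k}})"

(* A k-tuple of points is a function on {1..k}, extended by undefined elsewhere.
   The values are meaningful for k >= 1. *)
definition c :: "nat \<Rightarrow> real" where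
  "c k = (SUP T \<in> {1..k} \<rightarrow>\<^sub>E unit_circle. min_cost k T)"

(* The supremum is over a nonempty set that is bounded above, so Sup on the reals is
   the genuine supremum here. *)
lemma tuples_nonempty: "({1..k} \<rightarrow>\<^sub>E unit_circle) \<noteq> {}"
proof -
  have "norm (axis 1 1 :: real ^ 2) = 1" by simp
  then have "(axis 1 1 :: real ^ 2) \<in> unit_circle"
    by (simp add: unit_circle_def)
  then show ?thesis by (auto simp: PiE_eq_empty_iff)
qed

lemma bdd_above_min_cost:
  assumes "k \<ge> 1"
  shows "bdd_above (min_cost k ` ({1..k} \<rightarrow>\<^sub>E unit_circle))"
proof (rule bdd_aboveI2)
  fix T assume T: "T \<in> {1..k} \<rightarrow>\<^sub>E unit_circle"
  have n: "norm (T i) = 1" if "i \<in> {1..k}" for i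
    using PiE_mem[OF T that] by (simp add: unit_circle_def)
  have R: "norm R = 1"
    by (simp add: R_def norm_vec_def L2_set_def sum_2)
  have two: "dist x y \<le> 2" if "norm x = 1" "norm y = 1" for x y :: "real ^ 2"
    using norm_triangle_ineq4[of x y] that by (simp add: dist_norm)
  have "min_cost k T \<le> path_cost k T id"
    unfolding min_cost_def
    by (rule Min_le) (auto simp: finite_permutations permutes_id)
  also have "\<dots> \<le> 2 + (\<Sum>i = 2..k. 2)"
    unfolding path_cost_def id_apply
    using assms by (intro add_mono sum_mono two R n) auto
  finally show "min_cost k T \<le> 2 + (\<Sum>i = 2..k. 2)" .
qed


(* The degree-5 Taylor polynomial of sin, evaluated at pi / k and multiplied by 2 * k, has last
   term pi ^ 5 / (60 * k ^ 4). With k ^ 5 in that denominator, as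
   the inequality is printed in the source, it is false; it already fails for k = 2: *)
lemma sin_bound_with_fifth_power_false:
  "\<not> (\<forall>k::nat \<ge> 2. 2 * real k * sin (pi / real k)
      \<le> 2 * pi - pi ^ 3 / (3 * real k ^ 2) + pi ^ 5 / (60 * real k ^ 5))"
proof -
  have "pi ^ 2 \<le> 4 ^ 2"
    using pi_less_4 pi_gt_zero by (intro power_mono) auto
  then have "pi ^ 3 * pi ^ 2 \<le> pi ^ 3 * 16"
    by (intro mult_left_mono) auto
  then have fifth: "pi ^ 5 \<le> 16 * pi ^ 3"
    by (simp flip: power_add)
  have "0 \<le> (pi - 149 / 50) ^ 2 * (pi + 149 / 25)"
    using pi_gt_zero by simp
  also have "\<dots> = pi ^ 3 - 3 * (149 / 50) ^ 2 * pi + 2 * (149 / 50) ^ 3"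
    by (simp add: power2_eq_square power3_eq_cube field_simps)
  finally have "2 * pi - pi ^ 3 / (3 * 2 ^ 2) + pi ^ 5 / (60 * 2 ^ 5) < 4"
    using fifth pi_less_4 by (simp add: field_simps)
  then have "\<not> (2 * real 2 * sin (pi / real 2)
      \<le> 2 * pi - pi ^ 3 / (3 * real 2 ^ 2) + pi ^ 5 / (60 * real 2 ^ 5))"
    by simp
  then show ?thesis by blast
qed

end

theory Submission
  imports Defs
begin

text \<open>
  Walk around the circle counterclockwise from \<open>R\<close>, visiting the points in the order of their
  polar angles in \<open>[0, 2\<pi>)\<close>. The \<open>k\<close> chords of this path have lengths \<open>2 sin (g\<^sub>i)\<close>, where the half
  gaps \<open>g\<^sub>i \<ge> 0\<close> have sum at most \<open>\<pi>\<close>. By Jensen's inequality for the sine, which is concave on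
  \<open>[0, \<pi>]\<close>, the path has length at most \<open>2k sin (\<pi>/k)\<close>; here \<open>k \<ge> 2\<close> ensures that \<open>\<pi>/k\<close> lies in the
  range where the sine increases. The second inequality is the fifth-order Taylor bound.
\<close>

text \<open>In the order 5 Maclaurin expansion the Lagrange remainder is a sine times
  \<open>x ^ 5 / fact 5\<close>. As \<open>x > 0\<close>, bounding that sine by 1 gives the last
  term.\<close>

lemma sin_le_Taylor5:
  fixes x :: real
  assumes "0 < x"
  shows "sin x \<le> x - x ^ 3 / 6 + x ^ 5 / 120"
proof -
  obtain t where "sin x = (\<Sum>m<5. sin_coeff m * x ^ m) + sin (t + 1/2 * real 5 * pi) / fact 5 * x ^ 5"
    using Maclaurin_sin_expansion3[of 5 x] assms by auto
  moreover have "sin (t + 1/2 * real 5 * pi) / fact 5 * x ^ 5 \<le> 1 / fact 5 * x ^ 5"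
    using assms by (intro mult_right_mono divide_right_mono) auto
  moreover have "{..<5::nat} = {0, 1, 2, 3, 4}" by auto
  then have "(\<Sum>m<5. sin_coeff m * x ^ m) = x - x ^ 3 / 6"
    by (simp add: sin_coeff_def fact_numeral)
  moreover have "1 / fact 5 * x ^ 5 = x ^ 5 / 120"
    by (simp add: fact_numeral)
  ultimately show ?thesis by linarith
qed

lemma sin_concave_on: "concave_on {0..pi} sin"
proof (rule f''_le0_imp_concave)
  show "convex {0..pi}" by simp
  show "(sin has_real_derivative cos x) (at x)" for x by (rule DERIV_sin)
  show "(cos has_real_derivative - sin x) (at x)" for x by (rule DERIV_cos)
  show "- sin x \<le> 0" if "x \<in> {0..pi}" for x using that sin_ge_zero by simp
qed

text \<open>Jensen with equal weights bounds the average of the sines by the sine of the mean. The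
  sum may fall short of \<open>pi\<close>, so monotonicity of the sine then raises the mean to
  \<open>pi / card A\<close>, which is at most \<open>pi / 2\<close> since
  \<open>card A \<ge> 2\<close>.\<close>

lemma sum_sin_le:
  fixes x :: "'a \<Rightarrow> real"
  assumes A: "finite A" "card A \<ge> 2"
    and x: "\<And>i. i \<in> A \<Longrightarrow> x i \<in> {0..pi}" and sum: "sum x A \<le> pi"
  shows "(\<Sum>i\<in>A. sin (x i)) \<le> card A * sin (pi / card A)"
proof -
  let ?n = "real (card A)"
  have "A \<noteq> {}" using A by auto
  then have "sin (\<Sum>i\<in>A. (1 / ?n) *\<^sub>R x i) \<ge> (\<Sum>i\<in>A. 1 / ?n * sin (x i))"
    using A x by (intro concave_on_sum[OF _ _ sin_concave_on]) auto
  then have "(\<Sum>i\<in>A. sin (x i)) / ?n \<le> sin (sum x A / ?n)"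
    by (simp add: sum_divide_distrib)
  also have "\<dots> \<le> sin (pi / ?n)"
  proof (rule sin_monotone_2pi_le)
    have "0 \<le> sum x A" using x by (intro sum_nonneg) auto
    then show "- (pi / 2) \<le> sum x A / ?n"
      using pi_gt_zero by (smt (verit) divide_nonneg_nonneg of_nat_0_le_iff)
    show "sum x A / ?n \<le> pi / ?n" using sum by (intro divide_right_mono) auto
    show "pi / ?n \<le> pi / 2" using A by (intro divide_left_mono) auto
  qed
  finally show ?thesis using A by (simp add: field_simps)
qed

lemma sorting_permutation:
  fixes \<theta> :: "nat \<Rightarrow> 'a::linorder"
  obtains \<sigma> where "\<sigma> permutes {1..k}" "\<And>i j. 1 \<le> i \<Longrightarrow> i \<le> j \<Longrightarrow> j \<le> k \<Longrightarrow> \<theta> (\<sigma> i) \<le> \<theta> (\<sigma> j)"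
proof -
  define xs where "xs = sort_key \<theta> [1..<Suc k]"
  \<comment> \<open>Positions start at 1 and list indices at 0, hence \<open>i - 1\<close>;
    \<open>permutes\<close> demands the identity outside \<open>{1..k}\<close>.\<close>
  define \<sigma> where "\<sigma> i = (if i \<in> {1..k} then xs ! (i - 1) else i)" for i
  have len: "length xs = k" and set: "set xs = {1..k}" and "distinct xs"
    and sorted: "sorted (map \<theta> xs)"
    by (auto simp: xs_def simp del: upt_Suc)
  then have "bij_betw ((!) xs) {..<k} {1..k}"
    by (intro bij_betw_nth) auto
  moreover have "bij_betw (\<lambda>i. i - 1) {1..k} {..<k}"
    by (rule bij_betw_byWitness[where f' = Suc]) auto
  ultimately have "bij_betw ((!) xs \<circ> (\<lambda>i. i - 1)) {1..k} {1..k}"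
    by (metis bij_betw_trans)
  then have "bij_betw \<sigma> {1..k} {1..k}"
    by (rule bij_betw_cong[THEN iffD1, rotated]) (simp add: \<sigma>_def)
  then have "\<sigma> permutes {1..k}"
    by (rule bij_imp_permutes) (auto simp: \<sigma>_def)
  moreover have "\<theta> (\<sigma> i) \<le> \<theta> (\<sigma> j)" if "1 \<le> i" "i \<le> j" "j \<le> k" for i j
    using sorted_nth_mono[OF sorted, of "i - 1" "j - 1"] that len by (auto simp: \<sigma>_def)
  ultimately show ?thesis by (rule that)
qed

definition circle_point :: "real \<Rightarrow> real ^ 2" where
  "circle_point t = vector [cos t, sin t]"

lemma unit_circle_polar:
  assumes "p \<in> unit_circle"
  obtains t where "0 \<le> t" "t < 2 * pi" "p = circle_point t"
proof -
  have "(p $ 1)\<^sup>2 + (p $ 2)\<^sup>2 = 1"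
    using assms by (simp add: unit_circle_def norm_vec_def L2_set_def sum_2)
  then obtain t where "0 \<le> t" "t < 2 * pi" "p $ 1 = cos t" "p $ 2 = sin t"
    by (rule sincos_total_2pi)
  moreover from this have "p = circle_point t"
    by (simp add: circle_point_def vec_eq_iff forall_2)
  ultimately show ?thesis by (intro that)
qed

lemma dist_circle_point: "dist (circle_point a) (circle_point b) = 2 * \<bar>sin ((b - a) / 2)\<bar>"
proof -
  \<comment> \<open>Writing \<open>b - a\<close> as twice its half lets
    \<open>cos_double_sin\<close> turn the squared distance into a perfect square.\<close>
  have "cos (2 * ((b - a) / 2)) = cos b * cos a + sin b * sin a"
    unfolding cos_diff[symmetric] by (rule arg_cong[where f = cos]) simp
  then have "(cos a - cos b)\<^sup>2 + (sin a - sin b)\<^sup>2 = 2 - 2 * cos (2 * ((b - a) / 2))"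
    by (simp add: power2_diff sin_squared_eq)
  also have "\<dots> = (2 * sin ((b - a) / 2))\<^sup>2"
    unfolding cos_double_sin by (simp add: power_mult_distrib)
  finally show ?thesis
    by (simp add: dist_vec_def L2_set_def sum_2 dist_real_def circle_point_def
        real_sqrt_mult)
qed

lemma min_cost_le:
  assumes k: "k \<ge> 2" and T: "T \<in> {1..k} \<rightarrow>\<^sub>E unit_circle"
  shows "min_cost k T \<le> 2 * real k * sin (pi / real k)"
proof -
  have "\<exists>t. 0 \<le> t \<and> t < 2 * pi \<and> T i = circle_point t" if "i \<in> {1..k}" for i
    using unit_circle_polar[OF PiE_mem[OF T that]] by metis
  then obtain \<theta> where \<theta>: "0 \<le> \<theta> i" "\<theta> i < 2 * pi" "T i = circle_point (\<theta> i)"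
    if "i \<in> {1..k}" for i
    by metis
  obtain \<sigma> where \<sigma>: "\<sigma> permutes {1..k}"
    and mono: "\<And>i j. 1 \<le> i \<Longrightarrow> i \<le> j \<Longrightarrow> j \<le> k \<Longrightarrow> \<theta> (\<sigma> i) \<le> \<theta> (\<sigma> j)"
    using sorting_permutation[where \<theta> = \<theta> and k = k] by metis
  have \<sigma>_in: "\<sigma> i \<in> {1..k}" if "i \<in> {1..k}" for i
    using that permutes_in_image[OF \<sigma>] by simp
  \<comment> \<open>Index 0 stands for the start \<open>R\<close>, whose angle is 0, so that the
    first chord has the same form as the others.\<close>
  define \<phi> where "\<phi> i = (if i = 0 then 0 else \<theta> (\<sigma> i))" for i
  define g where "g i = (\<phi> i - \<phi> (i - 1)) / 2" for i
  have \<phi>: "0 \<le> \<phi> i" "\<phi> i < 2 * pi" if "i \<le> k" for i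
    using \<theta>[OF \<sigma>_in[of i]] that by (auto simp: \<phi>_def)
  have R: "R = circle_point (\<phi> 0)"
    by (simp add: R_def circle_point_def \<phi>_def)
  have T': "T (\<sigma> i) = circle_point (\<phi> i)" if "i \<in> {1..k}" for i
    using \<theta>(3)[OF \<sigma>_in[OF that]] that by (simp add: \<phi>_def)
  have g: "g i \<in> {0..pi}" if "i \<in> {1..k}" for i
  proof -
    have "\<phi> (i - 1) \<le> \<phi> i"
      using mono[of "i - 1" i] \<phi>(1)[of i] that by (cases "i = 1") (auto simp: \<phi>_def)
    moreover have "\<phi> i < 2 * pi" "0 \<le> \<phi> (i - 1)" using that by (auto intro: \<phi>)
    ultimately show ?thesis by (simp add: g_def)
  qed
  \<comment> \<open>The half gaps telescope. The arc from the last point back to \<open>R\<close> is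
    not walked, so what remains is \<open>\<phi> k / 2 < pi\<close>.\<close>
  have "sum g {1..k} = (\<phi> k - \<phi> 0) / 2"
    using sum_telescope''[of 0 k \<phi>] k
    by (simp add: g_def sum_divide_distrib[symmetric] atLeastSucAtMost_greaterThanAtMost[symmetric])
  then have sum: "sum g {1..k} \<le> pi" using \<phi>(2)[of k] by (simp add: \<phi>_def split: if_splits)
  \<comment> \<open>The absolute value in the chord length disappears because the half gap lies in
    \<open>{0..pi}\<close>.\<close>
  have step: "dist (circle_point (\<phi> (i - 1))) (circle_point (\<phi> i)) = 2 * sin (g i)"
    if "i \<in> {1..k}" for i
    using g[OF that] sin_ge_zero[of "g i"] by (simp add: dist_circle_point g_def)
  \<comment> \<open>The range starts at 2 because the predecessor of the first visited point is
    \<open>R\<close>, not a value of \<open>T\<close>.\<close>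
  have T_step: "dist (T (\<sigma> (i - 1))) (T (\<sigma> i)) = 2 * sin (g i)" if "i \<in> {2..k}" for i
  proof -
    have "i \<in> {1..k}" "i - 1 \<in> {1..k}" using that by auto
    then show ?thesis using T' step by metis
  qed
  have "path_cost k T \<sigma> = 2 * sin (g 1) + (\<Sum>i = 2..k. 2 * sin (g i))"
    unfolding path_cost_def R
    using k step[of 1] T'[of 1] T_step
    by (intro arg_cong2[where f = "(+)"] sum.cong) simp_all
  also have "\<dots> = (\<Sum>i = 1..k. 2 * sin (g i))"
    using k by (subst sum.atLeast_Suc_atMost[of 1]) (auto simp: numeral_2_eq_2)
  also have "\<dots> = 2 * (\<Sum>i = 1..k. sin (g i))" by (simp add: sum_distrib_left)
  also have "\<dots> \<le> 2 * (real k * sin (pi / real k))"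
    using sum_sin_le[of "{1..k}" g] g sum k by simp
  finally have "path_cost k T \<sigma> \<le> 2 * real k * sin (pi / real k)" by simp
  moreover have "min_cost k T \<le> path_cost k T \<sigma>"
    unfolding min_cost_def using \<sigma> by (intro Min_le) (auto simp: finite_permutations)
  ultimately show ?thesis by simp
qed

text \<open>Multiplying the Taylor bound at \<open>pi / k\<close> by \<open>2 * k\<close> cancels
  one factor \<open>k\<close>, hence \<open>k ^ 4\<close> in the last term; with
  \<open>k ^ 5\<close> the second inequality fails by
  \<open>sin_bound_with_fifth_power_false\<close>.\<close>

theorem lemma2:
  fixes k :: nat
  assumes "k \<ge> 2"
  shows "c k \<le> 2 * real k * sin (pi / real k)
    \<and> 2 * real k * sin (pi / real k)
        \<le> 2 * pi - pi ^ 3 / (3 * real k ^ 2) + pi ^ 5 / (60 * real k ^ 4)"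
proof
  show "c k \<le> 2 * real k * sin (pi / real k)"
    unfolding c_def using assms by (intro cSUP_least tuples_nonempty min_cost_le)
  have "2 * real k * sin (pi / real k)
      \<le> 2 * real k * (pi / real k - (pi / real k) ^ 3 / 6 + (pi / real k) ^ 5 / 120)"
    using assms by (intro mult_left_mono sin_le_Taylor5) auto
  also have "\<dots> = 2 * pi - pi ^ 3 / (3 * real k ^ 2) + pi ^ 5 / (60 * real k ^ 4)"
    using assms by (simp add: field_simps eval_nat_numeral)
  finally show "2 * real k * sin (pi / real k)
      \<le> 2 * pi - pi ^ 3 / (3 * real k ^ 2) + pi ^ 5 / (60 * real k ^ 4)" .
qed

end
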